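(* Let $\boldsymbol{\alpha}=\{\alpha_n\}_{n=0}^{\infty}$ be a sequence of complex numbers with $|\alpha_n|<1$ for all $n$ and $\alpha_n\rightarrow0$ as $n\rightarrow\infty$, and let $\tilde{\boldsymbol{\alpha}}=\{\tilde{\alpha}_n\}_{n=0}^{\infty}$ be its decreasing rearrangement. Assume that for all $N\in\mathbb{N}\cup\{0\}$ \[ \sum_{n=0}^N|\tilde{\alpha}_n|\leq f(N) \] for some increasing real-valued function $f$ satisfying $\lim_{n\rightarrow\infty}f(n)=\infty$. For each $n\in\mathbb{N}\cup\{0\}$ choose $\beta_n\in\partial\mathbb{D}$, and let $\{\Phi_{n+1}^{(\beta_n)}(z)\}_{n=0}^{\infty}$ be the paraorthogonal polynomials determined by $\{\alpha_n\}$ and $\{\beta_n\}$. Let $\{e^{i\theta_j^{(n+1)}}\}_{j=1}^{n+1}$ be the zeros of $\Phi_{n+1}^{(\beta_n)}(z)$, arranged so that $0\leq\theta_1^{(n+1)}<\theta_2^{(n+1)}<\cdots<\theta_{n+1}^{(n+1)}<2\pi$, and set $\theta_{n+2}^{(n+1)}=\theta_1^{(n+1)}+2\pi$. Then \[ \limsup_{n\rightarrow\infty}\left[\frac{n}{f(n)}\cdot\sup_{1\leq j\leq n+1}\left|\theta_{j+1}^{(n+1)}-\theta_{j}^{(n+1)}\right|\right]\leq4. \]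
   Context: $\mathbb{D}$ is the open unit disk in $\mathbb{C}$ and $\partial\mathbb{D}$ is the unit circle. Given a sequence $\{\alpha_n\}_{n=0}^\infty$ in $\mathbb{D}$ (the Verblunsky coefficients), the monic orthogonal polynomials on the unit circle $\{\Phi_n\}_{n=0}^\infty$ are determined by $\Phi_0(z)=1$ and the Szeg\H{o} recursion \[ \Phi_{n+1}(z)=z\Phi_n(z)-\overline{\alpha}_n\Phi_n^*(z),\qquad \Phi_n^*(z)=z^n\overline{\Phi_n(1/\overline{z})}. \] For $\beta_n\in\partial\mathbb{D}$, the degree $n+1$ paraorthogonal polynomial is \[ \Phi_{n+1}^{(\beta_n)}(z)=z\Phi_n(z)-\overline{\beta}_n\Phi_n^*(z). \] All $n+1$ zeros of $\Phi_{n+1}^{(\beta_n)}$ lie on $\partial\mathbb{D}$ and are simple. Decreasing rearrangement: for a sequence $\boldsymbol{\alpha}$ with $\alpha_n\to0$, $\tilde{\boldsymbol{\alpha}}=\{\tilde\alpha_n\}_{n=0}^\infty$ denotes a sequence listing the terms of $\boldsymbol{\alpha}$, with multiplicity, in order of nonincreasing modulus: $|\tilde{\alpha}_0|\geq|\tilde{\alpha}_1|\geq|\tilde{\alpha}_2|\geq\cdots$. (If infinitely many $\alpha_n$ are nonzero, only the nonzero terms are listed; if only finitely many are nonzero, these are listed first, followed by zeros.) *)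

theory Defs
  imports "HOL-Analysis.Analysis" "HOL-Computational_Algebra.Polynomial"
begin

text \<open>
  The reversal of \<open>p\<close> relative to degree \<open>n\<close>, i.e. the polynomial agreeing with
  \<open>z\<^sup>n * cnj (p (1 / cnj z))\<close> for \<open>z \<noteq> 0\<close> (lemma \<open>poly_star_poly\<close> below). It is defined by its
  coefficients, since that formula has no direct meaning at \<open>z = 0\<close>.
\<close>

definition star_poly :: "nat \<Rightarrow> complex poly \<Rightarrow> complex poly" where
  "star_poly n p = (\<Sum>k\<le>n. monom (cnj (coeff p (n - k))) k)"

primrec opuc :: "(nat \<Rightarrow> complex) \<Rightarrow> nat \<Rightarrow> complex poly" where
  "opuc \<alpha> 0 = 1"
| "opuc \<alpha> (Suc n) = [:0, 1:] * opuc \<alpha> n - smult (cnj (\<alpha> n)) (star_poly n (opuc \<alpha> n))"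

text \<open>The paraorthogonal polynomial of degree \<open>n + 1\<close> (not \<open>n\<close>) with parameter \<open>b = \<beta>\<^sub>n\<close>.\<close>

definition popuc :: "(nat \<Rightarrow> complex) \<Rightarrow> complex \<Rightarrow> nat \<Rightarrow> complex poly" where
  "popuc \<alpha> b n = [:0, 1:] * opuc \<alpha> n - smult (cnj b) (star_poly n (opuc \<alpha> n))"

text \<open>
  \<open>\<alpha>'\<close> is a decreasing rearrangement of \<open>\<alpha>\<close>. If infinitely many terms of \<open>\<alpha>\<close> are nonzero, exactly the
  nonzero terms are listed; otherwise these come first, followed by zeros. Terms of equal modulus
  may be listed in any order, so this is a relation rather than a function.
\<close>

definition decreasing_rearrangement :: "(nat \<Rightarrow> complex) \<Rightarrow> (nat \<Rightarrow> complex) \<Rightarrow> bool" where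
  "decreasing_rearrangement \<alpha> \<alpha>' \<longleftrightarrow>
     antimono (\<lambda>n. cmod (\<alpha>' n)) \<and>
     (let S = {n. \<alpha> n \<noteq> 0} in
      if infinite S
      then \<exists>\<sigma>. bij_betw \<sigma> UNIV S \<and> (\<forall>n. \<alpha>' n = \<alpha> (\<sigma> n))
      else \<exists>\<sigma>. bij_betw \<sigma> {..<card S} S \<and> (\<forall>n<card S. \<alpha>' n = \<alpha> (\<sigma> n)) \<and> (\<forall>n\<ge>card S. \<alpha>' n = 0))"

lemma poly_star_poly:
  assumes "degree p \<le> n" and "z \<noteq> 0"
  shows "poly (star_poly n p) z = z ^ n * cnj (poly p (1 / cnj z))"
proof -
  have "poly p (1 / cnj z) = (\<Sum>i\<le>n. coeff p i * (1 / cnj z) ^ i)"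
    unfolding poly_altdef using assms(1)
    by (intro sum.mono_neutral_left) (auto simp: coeff_eq_0)
  then have "z ^ n * cnj (poly p (1 / cnj z)) = (\<Sum>i\<le>n. cnj (coeff p i) * (z ^ n / z ^ i))"
    by (simp add: sum_distrib_left power_one_over field_simps)
  also have "\<dots> = (\<Sum>i\<le>n. cnj (coeff p i) * z ^ (n - i))"
    using assms(2) by (intro sum.cong) (auto simp: power_diff)
  also have "\<dots> = (\<Sum>k\<le>n. cnj (coeff p (n - k)) * z ^ k)"
    by (rule sum.reindex_bij_witness[where i = "\<lambda>k. n - k" and j = "\<lambda>k. n - k"]) auto
  finally show ?thesis
    by (simp add: star_poly_def poly_sum poly_monom)
qed

lemma degree_star_poly_le: "degree (star_poly n p) \<le> n"
  unfolding star_poly_def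
  by (intro degree_sum_le) (auto intro: order_trans[OF degree_monom_le])

lemma degree_opuc_le: "degree (opuc \<alpha> n) \<le> n"
proof (induction n)
  case (Suc n)
  have "degree ([:0, 1:] * opuc \<alpha> n) \<le> Suc n"
    using degree_mult_le[of "[:0, 1:]" "opuc \<alpha> n"] Suc by simp
  moreover have "degree (smult (cnj (\<alpha> n)) (star_poly n (opuc \<alpha> n))) \<le> Suc n"
    using degree_smult_le degree_star_poly_le le_SucI order_trans by metis
  ultimately show ?case
    by (simp only: opuc.simps degree_diff_le)
qed simp

end

theory Submission
  imports Defs
begin

text \<open>
  On the unit circle put \<open>z \<Phi>\<^sub>n(z) / \<Phi>\<^sub>n\<^sup>*(z) = e\<^bsup>i \<eta>\<^sub>n(t)\<^esup>\<close> for \<open>z = e\<^bsup>it\<^esup>\<close>. The Szego recursion becomes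
  \<open>\<eta>\<^sub>n\<^sub>+\<^sub>1(t) = t + \<eta>\<^sub>n(t) - 2 Arg (1 - \<alpha>\<^sub>n e\<^bsup>i \<eta>\<^sub>n(t)\<^esup>)\<close>, so \<open>\<eta>\<^sub>n(t)\<close> differs from \<open>(n + 1) t\<close> by at most
  twice the sum of \<open>\<bar>\<alpha>\<^sub>k\<bar> / (1 - \<bar>\<alpha>\<^sub>k\<bar>)\<close> over \<open>k < n\<close>. The zeros of the paraorthogonal polynomial are the
  points where \<open>\<eta>\<^sub>n(t)\<close> hits a fixed residue class modulo \<open>2\<pi>\<close>, so by the intermediate value theorem
  \<open>\<eta>\<^sub>n\<close> grows by at most \<open>2\<pi>\<close> between neighbouring zeros. This bounds \<open>n + 1\<close> times the gap by
  \<open>2\<pi>\<close> plus four times that sum, and since \<open>\<alpha>\<^sub>k \<rightarrow> 0\<close> the sum is at most \<open>(1 + \<epsilon>) f(n) + O(1)\<close>.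
\<close>

section \<open>Partial sums under rearrangement\<close>

text \<open>Induction adds a new maximum \<open>b\<close>. All of \<open>A\<close> lies below
  \<open>b\<close>, so \<open>card A \<le> b\<close> and \<open>b\<close> can be traded for the next
  free index \<open>card A\<close>.\<close>

lemma sum_antimono_le_initial:
  fixes g :: "nat \<Rightarrow> real"
  assumes "antimono g" and "finite B"
  shows "sum g B \<le> sum g {..<card B}"
  using assms(2)
proof (induction rule: finite_linorder_max_induct)
  case (insert b A)
  have "A \<subseteq> {..<b}" using insert by auto
  then have "card A \<le> b" using card_mono[of "{..<b}" A] by simp
  then have "g b \<le> g (card A)" using assms(1) by (simp add: antimonoD)
  moreover have "b \<notin> A" using insert by auto
  ultimately show ?case using insert by simp
qed simp

lemma sum_le_decreasing_rearrangement:
  assumes "decreasing_rearrangement \<alpha> \<alpha>'"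
  shows "(\<Sum>k<n. cmod (\<alpha> k)) \<le> (\<Sum>k<n. cmod (\<alpha>' k))"
proof -
  define S where "S = {n. \<alpha> n \<noteq> 0}"
  have anti: "antimono (\<lambda>n. cmod (\<alpha>' n))"
    using assms by (simp add: decreasing_rearrangement_def)
  \<comment> \<open>This merges both cases of the definition: \<open>I\<close> collects just the
    indices at which \<open>\<alpha>'\<close> lists nonzero terms, so any padding zeros lie outside
    it.\<close>
  obtain \<sigma> I where \<sigma>: "bij_betw \<sigma> I S" and eq: "\<And>i. i \<in> I \<Longrightarrow> \<alpha>' i = \<alpha> (\<sigma> i)"
  proof (cases "infinite S")
    case True
    then show thesis
      using assms that[of _ UNIV] unfolding decreasing_rearrangement_def S_def[symmetric]
      by (auto simp: Let_def)
  next
    case False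
    then show thesis
      using assms that[of _ "{..<card S}"] unfolding decreasing_rearrangement_def S_def[symmetric]
      by (auto simp: Let_def)
  qed
  define B where "B = {i \<in> I. \<sigma> i \<in> {..<n}}"
  have bij: "bij_betw \<sigma> B ({..<n} \<inter> S)"
    using \<sigma> unfolding B_def bij_betw_def inj_on_def by auto
  have fin: "finite B" and card: "card B \<le> n"
    using bij bij_betw_finite[OF bij] bij_betw_same_card[OF bij] card_mono[of "{..<n}" "{..<n} \<inter> S"]
    by auto
  have "(\<Sum>k<n. cmod (\<alpha> k)) = (\<Sum>k\<in>{..<n} \<inter> S. cmod (\<alpha> k))"
    by (rule sum.mono_neutral_right) (auto simp: S_def)
  also have "\<dots> = (\<Sum>i\<in>B. cmod (\<alpha> (\<sigma> i)))"
    using sum.reindex_bij_betw[OF bij, of "\<lambda>k. cmod (\<alpha> k)"] by simp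
  also have "\<dots> = (\<Sum>i\<in>B. cmod (\<alpha>' i))"
    using eq by (intro sum.cong) (auto simp: B_def)
  also have "\<dots> \<le> (\<Sum>i<card B. cmod (\<alpha>' i))"
    by (rule sum_antimono_le_initial[OF anti fin])
  also have "\<dots> \<le> (\<Sum>k<n. cmod (\<alpha>' k))"
    using card by (intro sum_mono2) auto
  finally show ?thesis .
qed

section \<open>The phase on the unit circle\<close>

text \<open>A crude bound suffices: its ratio to \<open>cmod u\<close> tends to 1 as
  \<open>u\<close> tends to 0, which is all that the final constant depends on.\<close>

lemma abs_Arg_one_minus_le:
  assumes "cmod u < 1"
  shows "\<bar>Arg (1 - u)\<bar> \<le> cmod u / (1 - cmod u)"
proof -
  have re: "1 - cmod u \<le> Re (1 - u)" using complex_Re_le_cmod[of u] by simp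
  have pos: "Re (1 - u) > 0" using re assms by simp
  have "\<bar>Arg (1 - u)\<bar> = \<bar>arctan (Im (1 - u) / Re (1 - u))\<bar>"
    using arg_conv_arctan[OF pos] by simp
  also have "\<dots> \<le> \<bar>Im (1 - u) / Re (1 - u)\<bar>"
    by (rule abs_arctan_le)
  also have "\<dots> = \<bar>Im u\<bar> / Re (1 - u)" using pos by simp
  also have "\<dots> \<le> cmod u / (1 - cmod u)"
    using re assms abs_Im_le_cmod[of u] by (intro frac_le) auto
  finally show ?thesis .
qed

text \<open>Real-valued recursion gives a continuous lift of the argument with no choice of branch:
  for coefficients in the disk, \<open>Arg\<close> is only applied in the right half-plane.\<close>

primrec prufer_phase :: "(nat \<Rightarrow> complex) \<Rightarrow> nat \<Rightarrow> real \<Rightarrow> real" where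
  "prufer_phase \<alpha> 0 t = t"
| "prufer_phase \<alpha> (Suc n) t =
     t + prufer_phase \<alpha> n t - 2 * Arg (1 - \<alpha> n * cis (prufer_phase \<alpha> n t))"

context
  fixes \<alpha> :: "nat \<Rightarrow> complex"
  assumes \<alpha>_less: "\<And>n. cmod (\<alpha> n) < 1"
begin

lemma Re_one_minus_pos: "Re (1 - \<alpha> n * cis x) > 0"
proof -
  have "Re (\<alpha> n * cis x) \<le> cmod (\<alpha> n * cis x)" by (rule complex_Re_le_cmod)
  also have "\<dots> < 1" using \<alpha>_less[of n] by (simp add: norm_mult)
  finally show ?thesis by simp
qed

lemma continuous_on_prufer_phase: "continuous_on A (prufer_phase \<alpha> n)"
proof (induction n)
  case 0
  then show ?case by (simp add: continuous_on_id)
next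
  case (Suc n)
  have "1 - \<alpha> n * cis x \<notin> \<real>\<^sub>\<le>\<^sub>0" for x
    using Re_one_minus_pos[of n x] by (auto simp: complex_nonpos_Reals_iff)
  then show ?case
    using Suc by (auto intro!: continuous_intros)
qed

lemma prufer_phase_bound:
  "\<bar>prufer_phase \<alpha> n t - (real n + 1) * t\<bar> \<le> 2 * (\<Sum>k<n. cmod (\<alpha> k) / (1 - cmod (\<alpha> k)))"
proof (induction n)
  case (Suc n)
  have "\<bar>Arg (1 - \<alpha> n * cis (prufer_phase \<alpha> n t))\<bar> \<le> cmod (\<alpha> n) / (1 - cmod (\<alpha> n))"
    using abs_Arg_one_minus_le[of "\<alpha> n * cis (prufer_phase \<alpha> n t)"] \<alpha>_less[of n]
    by (simp add: norm_mult)
  moreover have "(real (Suc n) + 1) * t = t + (real n + 1) * t" by (simp add: algebra_simps)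
  ultimately show ?case using Suc by simp
qed simp

text \<open>Rotating \<open>w\<close> by \<open>-2 * Arg w\<close> reflects it to
  \<open>cnj w\<close>, so the new phase factor is \<open>cis t * b * cnj w / w\<close>; then
  \<open>b * cnj b = 1\<close> simplifies \<open>b * cnj w\<close>.\<close>

lemma prufer_phase_step:
  "cis (prufer_phase \<alpha> (Suc n) t) * (1 - \<alpha> n * cis (prufer_phase \<alpha> n t)) =
   cis t * (cis (prufer_phase \<alpha> n t) - cnj (\<alpha> n))"
proof -
  define b where "b = cis (prufer_phase \<alpha> n t)"
  define w where "w = 1 - \<alpha> n * b"
  have bb: "b * cnj b = 1" by (simp add: b_def cis_cnj cis_mult)
  have w: "w = of_real (cmod w) * cis (Arg w)"
    using rcis_cmod_Arg[of w] by (simp add: rcis_def)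
  have "cis (- 2 * Arg w) * w = of_real (cmod w) * cis (- Arg w)"
    by (subst (2) w) (simp add: cis_mult mult.left_commute)
  also have "\<dots> = cnj w"
    by (subst (3) w) (simp add: cis_cnj)
  finally have "cis (- 2 * Arg w) * w = cnj w" .
  moreover have "cis (prufer_phase \<alpha> (Suc n) t) = cis t * b * cis (- 2 * Arg w)"
    by (simp add: b_def w_def cis_mult)
  ultimately have "cis (prufer_phase \<alpha> (Suc n) t) * w = cis t * (b * cnj w)"
    by (simp add: mult.assoc)
  also have "b * cnj w = b - cnj (\<alpha> n)"
    using bb by (simp add: w_def algebra_simps)
  finally show ?thesis by (simp add: w_def b_def)
qed

lemma star_opuc_on_circle:
  "poly (star_poly n (opuc \<alpha> n)) (cis t) = cis t ^ n * cnj (poly (opuc \<alpha> n) (cis t))"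
proof -
  have "1 / cnj (cis t) = cis t" by (simp add: cis_cnj divide_inverse)
  then show ?thesis
    using poly_star_poly[OF degree_opuc_le, of "cis t"] by simp
qed

text \<open>The nonvanishing is carried through the induction with the identity: each step
  multiplies the reversed value by \<open>1 - \<alpha> n * b\<close>, which has positive real
  part.\<close>

lemma opuc_prufer_phase:
  "cis t * poly (opuc \<alpha> n) (cis t) =
     cis (prufer_phase \<alpha> n t) * poly (star_poly n (opuc \<alpha> n)) (cis t) \<and>
   poly (star_poly n (opuc \<alpha> n)) (cis t) \<noteq> 0"
proof (induction n)
  case 0
  then show ?case by (simp add: star_poly_def)
next
  case (Suc n)
  define z where "z = cis t"
  define b where "b = cis (prufer_phase \<alpha> n t)"
  define p where "p = poly (opuc \<alpha> n) z"
  define q where "q = poly (star_poly n (opuc \<alpha> n)) z"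
  have zp: "z * p = b * q" and q0: "q \<noteq> 0"
    using Suc by (auto simp: z_def b_def p_def q_def)
  have zz: "z * cnj z = 1" and bb: "b * cnj b = 1"
    by (simp_all add: z_def b_def cis_cnj cis_mult)
  have q: "q = z ^ n * cnj p"
    using star_opuc_on_circle[of n t] by (simp add: q_def z_def p_def)
  have P: "poly (opuc \<alpha> (Suc n)) z = q * (b - cnj (\<alpha> n))"
    using zp by (simp add: p_def q_def algebra_simps)
  have "cnj q * z ^ n = p"
    using zz by (simp add: q mult.commute mult.left_commute flip: power_mult_distrib)
  then have "poly (star_poly (Suc n) (opuc \<alpha> (Suc n))) z = z * p * (cnj b - \<alpha> n)"
    using star_opuc_on_circle[of "Suc n" t] P
    by (simp add: z_def[symmetric] del: opuc.simps) (simp add: mult_ac)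
  also have "\<dots> = q * (1 - \<alpha> n * b)"
    using zp bb by (simp add: algebra_simps)
  finally have Q: "poly (star_poly (Suc n) (opuc \<alpha> (Suc n))) z = q * (1 - \<alpha> n * b)" .
  have "1 - \<alpha> n * b \<noteq> 0"
    using Re_one_minus_pos[of n "prufer_phase \<alpha> n t"] unfolding b_def by (metis order_less_irrefl zero_complex.sel(1))
  moreover have "cis (prufer_phase \<alpha> (Suc n) t) * (1 - \<alpha> n * b) = z * (b - cnj (\<alpha> n))"
    using prufer_phase_step by (simp add: b_def z_def)
  then have "cis (prufer_phase \<alpha> (Suc n) t) * (q * (1 - \<alpha> n * b)) = z * (q * (b - cnj (\<alpha> n)))"
    by (metis mult.left_commute)
  ultimately show ?case
    unfolding z_def[symmetric] P Q using q0 by simp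
qed

text \<open>On the circle the polynomial equals
  \<open>cis (prufer_phase \<alpha> n t) - cnj b\<close> times the nonzero reversed value.\<close>

lemma popuc_root_iff:
  "poly (popuc \<alpha> b n) (cis t) = 0 \<longleftrightarrow> cis (prufer_phase \<alpha> n t) = cnj b"
  using opuc_prufer_phase[of t n] by (simp add: popuc_def)

lemma popuc_gap_bound:
  assumes root: "poly (popuc \<alpha> b n) (cis s) = 0" and "s < t"
    and no_root: "\<And>x. s < x \<Longrightarrow> x < t \<Longrightarrow> poly (popuc \<alpha> b n) (cis x) \<noteq> 0"
  shows "(real n + 1) * (t - s) \<le> 2 * pi + 4 * (\<Sum>k<n. cmod (\<alpha> k) / (1 - cmod (\<alpha> k)))"
proof -
  let ?\<eta> = "prufer_phase \<alpha> n"
  have "?\<eta> t \<le> ?\<eta> s + 2 * pi"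
  proof (rule ccontr)
    assume less: "\<not> ?thesis"
    have "?\<eta> s \<le> ?\<eta> s + 2 * pi" "?\<eta> s + 2 * pi \<le> ?\<eta> t"
      using less pi_gt_zero by linarith+
    then obtain x where x: "s \<le> x" "x \<le> t" "?\<eta> x = ?\<eta> s + 2 * pi"
      using IVT'[of ?\<eta> s "?\<eta> s + 2 * pi" t] continuous_on_prufer_phase \<open>s < t\<close> by auto
    then have "x \<noteq> s" "x \<noteq> t" using less pi_gt_zero by auto
    moreover have "cis (?\<eta> x) = cis (?\<eta> s)" by (simp add: x(3) flip: cis_mult)
    ultimately show False
      using root no_root[of x] x(1,2) by (simp add: popuc_root_iff)
  qed
  \<comment> \<open>Each endpoint contributes an error of twice the sum, hence the factor 4.\<close>
  then show ?thesis
    using prufer_phase_bound[of n s] prufer_phase_bound[of n t]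
    by (simp add: right_diff_distrib)
qed

end

section \<open>Asymptotic comparison of the sums\<close>

lemma sum_div_one_minus_le:
  fixes r :: "nat \<Rightarrow> real"
  assumes "\<And>n. 0 \<le> r n" and "\<And>n. r n < 1" and "r \<longlonglongrightarrow> 0" and "\<epsilon> > 0"
  obtains C where "\<And>n. (\<Sum>k<n. r k / (1 - r k)) \<le> C + (1 + \<epsilon>) * (\<Sum>k<n. r k)"
proof -
  \<comment> \<open>Below this threshold \<open>1 / (1 - r n)\<close> is less than
    \<open>1 + \<epsilon>\<close>; the finitely many earlier terms go into \<open>C\<close>.\<close>
  have "\<forall>\<^sub>F n in sequentially. r n < \<epsilon> / (1 + \<epsilon>)"
    using assms by (intro order_tendstoD(2)[OF assms(3)]) auto
  then obtain K where K: "\<And>n. n \<ge> K \<Longrightarrow> r n < \<epsilon> / (1 + \<epsilon>)"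
    by (auto simp: eventually_sequentially)
  have tail: "r n / (1 - r n) \<le> (1 + \<epsilon>) * r n" if "n \<ge> K" for n
  proof -
    have "1 \<le> (1 + \<epsilon>) * (1 - r n)"
      using K[OF that] assms(4) by (simp add: field_simps)
    then have "r n * 1 \<le> r n * ((1 + \<epsilon>) * (1 - r n))"
      using assms(1) by (intro mult_left_mono) auto
    then show ?thesis using assms(2)[of n] by (simp add: field_simps)
  qed
  have "(\<Sum>k<n. r k / (1 - r k)) \<le> (\<Sum>k<K. r k / (1 - r k)) + (1 + \<epsilon>) * (\<Sum>k<n. r k)" for n
  proof -
    have nn: "0 \<le> r k / (1 - r k)" for k using assms(1,2)[of k] by simp
    \<comment> \<open>Early terms are counted twice on the right, which is harmless and also covers
      \<open>n < K\<close>.\<close>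
    have "(\<Sum>k<n. r k / (1 - r k)) \<le>
        (\<Sum>k<n. (if k < K then r k / (1 - r k) else 0) + (1 + \<epsilon>) * r k)"
      using tail assms(1,4) by (intro sum_mono) (auto simp: not_less)
    also have "\<dots> = (\<Sum>k<n. if k < K then r k / (1 - r k) else 0) + (1 + \<epsilon>) * (\<Sum>k<n. r k)"
      by (simp add: sum.distrib sum_distrib_left)
    also have "(\<Sum>k<n. if k < K then r k / (1 - r k) else 0) =
        (\<Sum>k\<in>{..<n} \<inter> {..<K}. r k / (1 - r k))"
      by (simp add: sum.inter_restrict)
    also have "\<dots> \<le> (\<Sum>k<K. r k / (1 - r k))"
      using nn by (intro sum_mono2) auto
    finally show ?thesis by simp
  qed
  then show thesis by (rule that)
qed

section \<open>Neighbouring zeros and the limit\<close>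

lemma cis_neq_cyclic_between:
  fixes \<theta> :: "nat \<Rightarrow> real"
  assumes mono: "strict_mono_on {1..m} \<theta>"
    and range: "\<And>j. j \<in> {1..m} \<Longrightarrow> 0 \<le> \<theta> j \<and> \<theta> j < 2 * pi"
    and wrap: "\<theta> (Suc m) = \<theta> 1 + 2 * pi"
    and j: "j \<in> {1..m}" and k: "k \<in> {1..m}"
    and x: "\<theta> j < x" "x < \<theta> (Suc j)"
  shows "cis x \<noteq> cis (\<theta> k)"
proof
  assume "cis x = cis (\<theta> k)"
  then have "cis (x - \<theta> k) = 1" by (simp flip: cis_divide)
  then have "cos (x - \<theta> k) = 1" by (simp add: complex_eq_iff)
  then obtain i :: int where i: "x - \<theta> k = of_int i * 2 * pi"
    by (auto simp: cos_one_2pi_int)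
  have le: "\<theta> a \<le> \<theta> b" if "a \<in> {1..m}" "b \<in> {1..m}" "a \<le> b" for a b
    using strict_mono_on_leD[OF mono] that by blast
  have "- (2 * pi) < x - \<theta> k" using range[OF j] range[OF k] x(1) by linarith
  then have "(of_int i + 1) * (2 * pi) > 0" using i by (simp add: algebra_simps)
  then have lo: "i \<ge> 0" by (simp add: zero_less_mult_iff)
  show False
  proof (cases "j = m")
    case False
    then have Sj: "Suc j \<in> {1..m}" using j by simp
    have "x - \<theta> k < 2 * pi" using range[OF Sj] range[OF k] x(2) by linarith
    then have "(1 - of_int i) * (2 * pi) > 0" using i by (simp add: algebra_simps)
    then have "i < 1" by (simp add: zero_less_mult_iff)
    then have "i = 0" using lo by simp
    then have "x = \<theta> k" using i by simp
    then show False
      using le[OF k j] le[OF Sj k] x by (cases "k \<le> j") auto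
  next
    case True
    \<comment> \<open>The last arc may cross \<open>2 * pi\<close>, so \<open>x\<close> is compared
      with \<open>\<theta> 1 + 2 * pi\<close>; no multiple of \<open>2 * pi\<close> lies strictly
      between 0 and \<open>2 * pi\<close>.\<close>
    have "\<theta> 1 \<le> \<theta> k" "\<theta> k \<le> \<theta> m" using k le by auto
    then have "0 < x - \<theta> k" "x - \<theta> k < 2 * pi" using x True wrap by auto
    then have "of_int i * (2 * pi) > 0" "(1 - of_int i) * (2 * pi) > 0"
      using i by (simp_all add: algebra_simps)
    then show False by (simp add: zero_less_mult_iff)
  qed
qed

theorem theorem2p2:
  fixes \<alpha> \<alpha>' \<beta> :: "nat \<Rightarrow> complex"
    and f :: "nat \<Rightarrow> real"
    and \<theta> :: "nat \<Rightarrow> nat \<Rightarrow> real"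
  assumes "\<And>n. cmod (\<alpha> n) < 1"
    and "\<alpha> \<longlonglongrightarrow> 0"
    and "decreasing_rearrangement \<alpha> \<alpha>'"
    and "mono f"
    and "filterlim f at_top sequentially"
    and "\<And>N. (\<Sum>n\<le>N. cmod (\<alpha>' n)) \<le> f N"
    and "\<And>n. cmod (\<beta> n) = 1"
    and "\<And>n. {z. poly (popuc \<alpha> (\<beta> n) n) z = 0} = (\<lambda>j. cis (\<theta> (n + 1) j)) ` {1..n + 1}"
    and "\<And>n. strict_mono_on {1..n + 1} (\<theta> (n + 1))"
    and "\<And>n j. j \<in> {1..n + 1} \<Longrightarrow> 0 \<le> \<theta> (n + 1) j \<and> \<theta> (n + 1) j < 2 * pi"
    and "\<And>n. \<theta> (n + 1) (n + 2) = \<theta> (n + 1) 1 + 2 * pi"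
  shows "limsup (\<lambda>n. ereal (real n / f n *
           (SUP j\<in>{1..n + 1}. \<bar>\<theta> (n + 1) (j + 1) - \<theta> (n + 1) j\<bar>))) \<le> 4"
proof -
  let ?gap = "\<lambda>n. SUP j\<in>{1..n + 1}. \<bar>\<theta> (n + 1) (j + 1) - \<theta> (n + 1) j\<bar>"
  let ?s = "\<lambda>n. \<Sum>k<n. cmod (\<alpha> k) / (1 - cmod (\<alpha> k))"
  have gap1: "(real n + 1) * \<bar>\<theta> (n + 1) (j + 1) - \<theta> (n + 1) j\<bar> \<le> 2 * pi + 4 * ?s n"
    if j: "j \<in> {1..n + 1}" for n j
  proof -
    have less: "\<theta> (n + 1) j < \<theta> (n + 1) (j + 1)"
    proof (cases "j = n + 1")
      case True
      then show ?thesis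
        using assms(10)[of j n] assms(10)[of 1 n] assms(11)[of n] by simp
    next
      case False
      then show ?thesis
        using j strict_mono_onD[OF assms(9)[of n], of j "j + 1"] by simp
    qed
    have root: "poly (popuc \<alpha> (\<beta> n) n) (cis (\<theta> (n + 1) j)) = 0"
      using assms(8)[of n] j by blast
    have "poly (popuc \<alpha> (\<beta> n) n) (cis x) \<noteq> 0"
      if x: "\<theta> (n + 1) j < x" "x < \<theta> (n + 1) (j + 1)" for x
    proof
      assume "poly (popuc \<alpha> (\<beta> n) n) (cis x) = 0"
      then obtain k where k: "k \<in> {1..n + 1}" "cis x = cis (\<theta> (n + 1) k)"
        using assms(8)[of n] by blast
      then show False
        using cis_neq_cyclic_between[OF assms(9)[of n] assms(10) _ j k(1)] x assms(11)[of n]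
        by simp
    qed
    from popuc_gap_bound[OF assms(1) root less this] show ?thesis
      using less by simp
  qed
  have gap: "(real n + 1) * ?gap n \<le> 2 * pi + 4 * ?s n" for n
  proof -
    have "?gap n \<le> (2 * pi + 4 * ?s n) / (real n + 1)"
      using gap1[of _ n] by (intro cSUP_least) (auto simp: field_simps)
    then show ?thesis by (simp add: field_simps)
  qed
  have gap_nonneg: "?gap n \<ge> 0" for n
    by (rule cSUP_upper2[of _ _ 1]) auto
  \<comment> \<open>\<open>f n\<close> bounds \<open>n + 1\<close> terms of
    \<open>\<alpha>'\<close>; dropping the last one matches the \<open>n\<close> coefficients
    entering the phase.\<close>
  have sum_le: "(\<Sum>k<n. cmod (\<alpha> k)) \<le> f n" for n
    using sum_le_decreasing_rearrangement[OF assms(3), of n] assms(6)[of n]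
      sum_mono2[of "{..n}" "{..<n}" "\<lambda>k. cmod (\<alpha>' k)"] by fastforce
  show ?thesis
  proof (rule ereal_le_epsilon2)
    fix e :: real
    assume "e > 0"
    \<comment> \<open>After the factor 4, \<open>e / 8\<close> costs half of \<open>e\<close>; the
      other half absorbs the constant.\<close>
    then obtain C where C: "\<And>n. ?s n \<le> C + (1 + e / 8) * (\<Sum>k<n. cmod (\<alpha> k))"
      using sum_div_one_minus_le[of "\<lambda>k. cmod (\<alpha> k)" "e / 8"] assms(1,2)
      by (auto simp: tendsto_norm_zero)
    \<comment> \<open>The 1 makes \<open>f n\<close> positive for the division; the other bound
      gives \<open>2 * pi + 4 * C \<le> e / 2 * f n\<close>.\<close>
    have "\<forall>\<^sub>F n in sequentially. f n \<ge> max 1 ((2 * pi + 4 * C) * 2 / e)"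
      using assms(5) unfolding filterlim_at_top by blast
    then have "\<forall>\<^sub>F n in sequentially. ereal (real n / f n * ?gap n) \<le> 4 + ereal e"
    proof eventually_elim
      case (elim n)
      have "real n * ?gap n \<le> (real n + 1) * ?gap n"
        using gap_nonneg[of n] by (intro mult_right_mono) auto
      also have "\<dots> \<le> 2 * pi + 4 * ?s n" by (rule gap)
      also have "\<dots> \<le> 2 * pi + 4 * (C + (1 + e / 8) * (\<Sum>k<n. cmod (\<alpha> k)))"
        using C[of n] by simp
      also have "\<dots> \<le> 2 * pi + 4 * (C + (1 + e / 8) * f n)"
        using sum_le[of n] \<open>e > 0\<close> by (simp add: mult_left_mono)
      also have "\<dots> = (2 * pi + 4 * C) + (4 + e / 2) * f n" by (simp add: algebra_simps)
      also have "\<dots> \<le> e / 2 * f n + (4 + e / 2) * f n"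
        using elim \<open>e > 0\<close> by (simp add: field_simps)
      also have "\<dots> = (4 + e) * f n" by (simp add: algebra_simps)
      finally have "real n / f n * ?gap n \<le> 4 + e"
        using elim by (simp add: field_simps)
      then have "ereal (real n / f n * ?gap n) \<le> ereal (4 + e)" by (simp only: ereal_less_eq)
      then show ?case by simp
    qed
    then show "limsup (\<lambda>n. ereal (real n / f n * ?gap n)) \<le> 4 + ereal e"
      by (rule Limsup_bounded)
  qed
qed

end
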